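(* Let $N\ge 3$. For $0\le k\le N-2$ choose $\pi_k$ independently and uniformly at random from the $(k+2)$-element set $\Pi_k$. Then $\pi=\pi_0\pi_1\cdots\pi_{N-2}$ is a uniformly distributed random element of the symmetric group $\mathcal{S}_N$, i.e. each permutation in $\mathcal{S}_N$ is obtained with probability $1/N!$. Moreover $\pi$ is produced as a product of at most $N(N-1)/2$ adjacent transpositions, so that (counting multiplication by one adjacent transposition as $O(1)$ time, and assuming the $N-1$ choices are made in parallel in $O(1)$ time) the worst-case time complexity of this random sampling procedure is $O(N^2)$.
   Context: $\mathcal{S}_N$ is the group of permutations of $\{0,1,\ldots,N-1\}$ and $s_j=(j,j+1)$, $0\le j\le N-2$, are the adjacent transpositions. A product $\pi s_j$ is composition with $s_j$ applied first, so multiplying $\pi$ on the right by $s_j$ interchanges the $j$-th and $(j+1)$-th entries of the array $[\pi(0),\ldots,\pi(N-1)]$. For $0\le k\le N-2$, $$\Pi_k=\{I,\ s_k,\ s_ks_{k-1},\ s_ks_{k-1}s_{k-2},\ \ldots,\ s_ks_{k-1}\cdots s_0\},\qquad |\Pi_k|=k+2,$$ where $I$ is the identity. *)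

theory Defs
  imports
    "HOL-Probability.Probability"
    "HOL-Combinatorics.Permutations"
    "HOL-Library.Landau_Symbols"
begin

(* Permutations of {0,...,N-1} are functions on nat that are the identity outside this set,
   as in the library predicate permutes. *)
definition Sym :: "nat \<Rightarrow> (nat \<Rightarrow> nat) set" where
  "Sym N = {p. p permutes {0..<N}}"

definition adj :: "nat \<Rightarrow> nat \<Rightarrow> nat" where
  "adj j = Transposition.transpose j (Suc j)"

(* comp_list [p, q, ..., r] = p \<circ> q \<circ> ... \<circ> r, so the rightmost factor acts first *)
definition comp_list :: "('a \<Rightarrow> 'a) list \<Rightarrow> 'a \<Rightarrow> 'a" where
  "comp_list ps = foldr (\<circ>) ps id"

(* desc k m = [k, k - 1, ..., k - m + 1], for m \<le> k + 1 *)
definition desc :: "nat \<Rightarrow> nat \<Rightarrow> nat list" where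
  "desc k m = take m (rev [0..<Suc k])"

(* chain k m = s_k s_(k-1) ... s_(k-m+1); chain k 0 = I *)
definition chain :: "nat \<Rightarrow> nat \<Rightarrow> nat \<Rightarrow> nat" where
  "chain k m = comp_list (map adj (desc k m))"

definition PiSet :: "nat \<Rightarrow> (nat \<Rightarrow> nat) set" where
  "PiSet k = chain k ` {0..k + 1}"

lemma desc_Suc: "m \<le> k \<Longrightarrow> desc k (Suc m) = desc k m @ [k - m]"
  unfolding desc_def by (simp add: take_Suc_conv_app_nth rev_nth del: upt_Suc)

lemma comp_list_Nil [simp]: "comp_list [] = id"
  and comp_list_Cons [simp]: "comp_list (p # ps) = p \<circ> comp_list ps"
  by (simp_all add: comp_list_def)

lemma comp_list_append: "comp_list (ps @ qs) = comp_list ps \<circ> comp_list qs"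
  by (induction ps) (simp_all add: comp_assoc)

lemma chain_0: "chain k 0 = id"
  by (simp add: chain_def desc_def)

lemma chain_Suc: "m \<le> k \<Longrightarrow> chain k (Suc m) = chain k m \<circ> adj (k - m)"
  by (simp add: chain_def desc_Suc comp_list_append)

lemma inj_chain: "m \<le> k + 1 \<Longrightarrow> inj (chain k m)"
proof (induction m)
  case (Suc m)
  then have "inj (chain k m)" and "m \<le> k" by simp_all
  then show ?case
    unfolding chain_Suc[OF \<open>m \<le> k\<close>]
    by (intro inj_compose) (simp_all add: adj_def bij_is_inj)
qed (simp add: chain_0)

lemma chain_apply: "m \<le> k + 1 \<Longrightarrow> chain k m (k + 1 - m) = k + 1"
proof (induction m)
  case (Suc m)
  then show ?case by (simp add: chain_Suc adj_def Suc_diff_le)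
qed (simp add: chain_0)

lemma inj_on_chain: "inj_on (chain k) {0..k + 1}"
proof (rule inj_onI)
  fix m n assume *: "m \<in> {0..k + 1}" "n \<in> {0..k + 1}" "chain k m = chain k n"
  then have "chain k m (k + 1 - m) = chain k m (k + 1 - n)"
    using chain_apply[of m k] chain_apply[of n k] by simp
  then have "k + 1 - m = k + 1 - n"
    using inj_chain[of m k] * by (simp add: inj_eq)
  then show "m = n" using * by simp
qed

lemma card_PiSet: "card (PiSet k) = k + 2"
  unfolding PiSet_def by (subst card_image[OF inj_on_chain]) simp

(* the descending word s_k s_(k-1) ... representing p \<in> PiSet k;
   it is unique by inj_on_chain *)
definition word :: "nat \<Rightarrow> (nat \<Rightarrow> nat) \<Rightarrow> nat list" where
  "word k p = desc k (THE m. m \<le> k + 1 \<and> chain k m = p)"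

lemma word_chain: "m \<le> k + 1 \<Longrightarrow> word k (chain k m) = desc k m"
proof -
  assume m: "m \<le> k + 1"
  have "(THE n. n \<le> k + 1 \<and> chain k n = chain k m) = m"
    using m inj_on_chain[of k] by (intro the_equality) (auto dest: inj_onD)
  then show ?thesis by (simp add: word_def)
qed

(* A choice of factors is a family q with q k \<in> PiSet k for k < N - 1, that is 0 \<le> k \<le> N - 2;
   the values outside this range are irrelevant (Pi_pmf sets them to id). *)
definition choices :: "nat \<Rightarrow> (nat \<Rightarrow> nat \<Rightarrow> nat) pmf" where
  "choices N = Pi_pmf {..<N - 1} id (\<lambda>k. pmf_of_set (PiSet k))"

definition prod_perm :: "nat \<Rightarrow> (nat \<Rightarrow> nat \<Rightarrow> nat) \<Rightarrow> nat \<Rightarrow> nat" where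
  "prod_perm N q = comp_list (map q [0..<N - 1])"

(* the adjacent transpositions that are successively multiplied on the right *)
definition factors :: "nat \<Rightarrow> (nat \<Rightarrow> nat \<Rightarrow> nat) \<Rightarrow> nat list" where
  "factors N q = concat (map (\<lambda>k. word k (q k)) [0..<N - 1])"

(* Cost model: the state is (current permutation, elapsed time), and
   tm p j is the time needed to multiply p on the right by s_j. *)
fun exec :: "((nat \<Rightarrow> nat) \<Rightarrow> nat \<Rightarrow> real) \<Rightarrow> nat list \<Rightarrow> (nat \<Rightarrow> nat) \<times> real \<Rightarrow> (nat \<Rightarrow> nat) \<times> real" where
  "exec tm [] st = st"
| "exec tm (j # js) (p, t) = exec tm js (p \<circ> adj j, t + tm p j)"

(* tc N is the time needed to make the N - 1 choices in parallel. *)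
definition run ::
  "(nat \<Rightarrow> real) \<Rightarrow> (nat \<Rightarrow> (nat \<Rightarrow> nat) \<Rightarrow> nat \<Rightarrow> real) \<Rightarrow> nat \<Rightarrow> (nat \<Rightarrow> nat \<Rightarrow> nat) \<Rightarrow> (nat \<Rightarrow> nat) \<times> real" where
  "run tc tm N q = exec (tm N) (factors N q) (id, tc N)"

definition worst_time :: "(nat \<Rightarrow> real) \<Rightarrow> (nat \<Rightarrow> (nat \<Rightarrow> nat) \<Rightarrow> nat \<Rightarrow> real) \<Rightarrow> nat \<Rightarrow> real" where
  "worst_time tc tm N = Max ((\<lambda>q. snd (run tc tm N q)) ` set_pmf (choices N))"

lemma finite_set_pmf_choices: "finite (set_pmf (choices N))"
proof -
  have "finite (set_pmf (pmf_of_set (PiSet k)))" for k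
    by (subst set_pmf_of_set) (auto simp: PiSet_def)
  then show ?thesis
    by (auto simp: choices_def set_Pi_pmf intro!: finite_PiE_dflt)
qed

end

theory Submission imports Defs begin

text \<open>The chain s_k ... s_(k-m+1) sends k + 1 - m to k + 1, whereas the factors with smaller index fix
  k + 1. So the position at which the product takes the value k + 1 determines the last factor, and
  the factors can be recovered one after the other from their product. As there are N! choices and
  N! permutations, taking the product is a bijection.\<close>

section \<open>Words of adjacent transpositions\<close>

lemma comp_list_concat: "comp_list (concat pss) = comp_list (map comp_list pss)"
  by (induction pss) (simp_all add: comp_list_append)

lemma comp_list_permutes: "(\<And>p. p \<in> set ps \<Longrightarrow> p permutes S) \<Longrightarrow> comp_list ps permutes S"
  by (induction ps) (auto simp: permutes_id intro: permutes_compose)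

lemma adj_permutes: "Suc j < N \<Longrightarrow> adj j permutes {0..<N}"
  unfolding adj_def by (rule permutes_swap_id) auto

lemma set_desc: "set (desc k m) \<subseteq> {0..k}"
  using set_take_subset[of m "rev [0..<Suc k]"] by (auto simp: desc_def)

lemma length_desc: "length (desc k m) = min m (Suc k)"
  by (simp add: desc_def del: upt_Suc)

lemma PiSet_permutes:
  assumes "p \<in> PiSet k" "k + 1 < N"
  shows "p permutes {0..<N}"
proof -
  obtain m where "p = chain k m"
    using assms(1) by (auto simp: PiSet_def)
  then show ?thesis
    using set_desc[of k m] assms(2)
    by (fastforce simp: chain_def intro!: comp_list_permutes adj_permutes)
qed

text \<open>An element of \<open>PiSet k\<close> is \<open>chain k m\<close> for some m <= k + 1,
  and \<open>word\<close> recovers the descending word of that chain. The index and length bounds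
  are later collected over all k.\<close>

lemma word_PiSet:
  assumes "p \<in> PiSet k"
  shows comp_list_word: "comp_list (map adj (word k p)) = p"
    and set_word: "set (word k p) \<subseteq> {0..k}"
    and length_word: "length (word k p) \<le> k + 1"
proof -
  obtain m where "m \<le> k + 1" "p = chain k m"
    using assms by (auto simp: PiSet_def)
  then show "comp_list (map adj (word k p)) = p" "set (word k p) \<subseteq> {0..k}" "length (word k p) \<le> k + 1"
    using set_desc[of k m] by (simp_all add: word_chain length_desc flip: chain_def)
qed

section \<open>Products of one factor from each \<open>PiSet k\<close>\<close>

lemma comp_list_PiSet_permutes:
  assumes "\<And>k. k < M \<Longrightarrow> q k \<in> PiSet k"
  shows "comp_list (map q [0..<M]) permutes {0..<Suc M}"
proof (rule comp_list_permutes)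
  fix p assume "p \<in> set (map q [0..<M])"
  then obtain k where "k < M" "p = q k"
    by auto
  then show "p permutes {0..<Suc M}"
    using assms[of k] by (simp add: PiSet_permutes)
qed

text \<open>Induction on the number of factors: once the last factors are known to agree, they
  cancel on the right and leave equal shorter products.\<close>

lemma comp_list_PiSet_unique:
  assumes "\<And>k. k < M \<Longrightarrow> q k \<in> PiSet k" "\<And>k. k < M \<Longrightarrow> r k \<in> PiSet k"
    and "comp_list (map q [0..<M]) = comp_list (map r [0..<M])"
    and "k < M"
  shows "q k = r k"
  using assms
proof (induction M arbitrary: k)
  case (Suc M)
  let ?Q = "comp_list (map q [0..<M])" and ?R = "comp_list (map r [0..<M])"
  have eq: "?Q \<circ> q M = ?R \<circ> r M"
    using Suc.prems(3) by (simp add: comp_list_append comp_def)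
  obtain m n where m: "m \<le> M + 1" "q M = chain M m" and n: "n \<le> M + 1" "r M = chain M n"
    using Suc.prems(1)[of M] Suc.prems(2)[of M] by (auto simp: PiSet_def)
  have Q: "?Q permutes {0..<Suc M}" and R: "?R permutes {0..<Suc M}"
    using Suc.prems(1,2) by (auto intro!: comp_list_PiSet_permutes)
  \<comment> \<open>\<open>?Q\<close> permutes only \<open>{0..<Suc M}\<close> and hence fixes
    \<open>M + 1\<close>, the value of \<open>q M\<close> at \<open>M + 1 - m\<close>.\<close>
  have "(?Q \<circ> q M) (M + 1 - m) = M + 1"
    using m permutes_not_in[OF Q, of "M + 1"] chain_apply[of m M] by simp
  moreover have "(?Q \<circ> q M) (M + 1 - n) = M + 1"
    unfolding eq using n permutes_not_in[OF R, of "M + 1"] chain_apply[of n M] by simp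
  moreover have "inj (?Q \<circ> q M)"
    using m inj_chain[of m M] permutes_inj[OF Q] by (simp add: inj_compose)
  ultimately have "M + 1 - m = M + 1 - n"
    by (metis injD)
  \<comment> \<open>Truncated subtraction cancels here because \<open>m\<close> and \<open>n\<close>
    are both at most \<open>M + 1\<close>.\<close>
  then have "m = n"
    using m n by simp
  then have last: "q M = r M"
    using m n by simp
  \<comment> \<open>Surjectivity allows right cancellation. The size \<open>M + 2\<close> is the
    least one for which all of \<open>PiSet M\<close> acts on \<open>{0..<M + 2}\<close>.\<close>
  have "surj (q M)"
    using PiSet_permutes[of "q M" M "M + 2"] Suc.prems(1)[of M] by (simp add: permutes_surj)
  then have "?Q = ?R"
    using eq last by (metis surj_fun_eq fun.map_comp comp_apply surjD ext)
  then show ?case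
    using Suc.IH[of k] Suc.prems last by (cases "k = M") auto
qed simp

section \<open>Counting the choices and the uniform distribution\<close>

lemma card_PiE_dflt_PiSet: "card (PiE_dflt {..<M} id PiSet) = fact (Suc M)"
proof -
  have "(\<Prod>k<M. k + 2) = fact (Suc M)"
    by (induction M) simp_all
  moreover have "finite (PiSet k)" for k
    by (simp add: PiSet_def)
  ultimately show ?thesis
    by (simp add: card_PiE_dflt card_PiSet)
qed

text \<open>Surjectivity comes from counting: by injectivity the image has N! elements, and it lies
  in \<open>Sym N\<close>, which has just as many.\<close>

lemma bij_betw_prod_perm:
  assumes "N \<ge> 1"
  shows "bij_betw (prod_perm N) (PiE_dflt {..<N - 1} id PiSet) (Sym N)"
proof -
  let ?A = "PiE_dflt {..<N - 1} id PiSet"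
  have inj: "inj_on (prod_perm N) ?A"
  proof (rule inj_onI, rule ext)
    fix q r k assume *: "q \<in> ?A" "r \<in> ?A" "prod_perm N q = prod_perm N r"
    show "q k = r k"
    \<comment> \<open>Beyond the N - 1 factors both families take the default value
      \<open>id\<close>.\<close>
    proof (cases "k < N - 1")
      case True
      then show ?thesis
        using * by (intro comp_list_PiSet_unique[of "N - 1" q r]) (auto simp: prod_perm_def PiE_dflt_def)
    qed (use * in \<open>auto simp: PiE_dflt_def\<close>)
  qed
  have "prod_perm N q \<in> Sym N" if "q \<in> ?A" for q
    using comp_list_PiSet_permutes[of "N - 1" q] that assms
    by (simp add: prod_perm_def Sym_def PiE_dflt_def)
  moreover have "finite (Sym N)" "card (Sym N) = card (prod_perm N ` ?A)"
    using assms card_PiE_dflt_PiSet[of "N - 1"] card_image[OF inj]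
    by (simp_all add: Sym_def finite_permutations card_permutations[OF refl])
  ultimately have "prod_perm N ` ?A = Sym N"
    by (intro card_subset_eq) auto
  with inj show ?thesis
    by (simp add: bij_betw_def)
qed

text \<open>Independent uniform choices from finite sets are jointly uniform on the product set, and
  a bijection carries a uniform distribution to a uniform one.\<close>

lemma map_pmf_prod_perm_choices:
  assumes "N \<ge> 1"
  shows "map_pmf (prod_perm N) (choices N) = pmf_of_set (Sym N)"
proof -
  have fin: "finite (PiSet k)" and ne: "PiSet k \<noteq> {}" for k
    by (auto simp: PiSet_def)
  have "choices N = pmf_of_set (PiE_dflt {..<N - 1} id PiSet)"
    unfolding choices_def using fin ne by (intro Pi_pmf_of_set) auto
  moreover have "PiE_dflt {..<N - 1} id PiSet \<noteq> {}" "finite (PiE_dflt {..<N - 1} id PiSet)"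
    using fin ne by (auto intro!: finite_PiE_dflt)
  ultimately show ?thesis
    using map_pmf_of_set_bij_betw[OF bij_betw_prod_perm[OF assms]] by simp
qed

section \<open>Expansion into adjacent transpositions\<close>

lemma comp_list_factors:
  assumes "\<And>k. k < N - 1 \<Longrightarrow> q k \<in> PiSet k"
  shows "comp_list (map adj (factors N q)) = prod_perm N q"
proof -
  have "map (\<lambda>k. comp_list (map adj (word k (q k)))) [0..<N - 1] = map q [0..<N - 1]"
    using assms by (simp add: comp_list_word)
  then show ?thesis
    by (simp only: factors_def prod_perm_def map_concat comp_list_concat map_map comp_def)
qed

lemma set_factors:
  assumes "\<And>k. k < N - 1 \<Longrightarrow> q k \<in> PiSet k"
  shows "set (factors N q) \<subseteq> {0..N - 2}"
proof
  fix j assume "j \<in> set (factors N q)"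
  then obtain k where "k < N - 1" "j \<in> set (word k (q k))"
    by (auto simp: factors_def)
  then show "j \<in> {0..N - 2}"
    using set_word[OF assms, of k] by auto
qed

lemma length_factors:
  assumes "\<And>k. k < N - 1 \<Longrightarrow> q k \<in> PiSet k"
  shows "length (factors N q) \<le> N * (N - 1) div 2"
proof -
  have "length (factors N q) = (\<Sum>k<N - 1. length (word k (q k)))"
    by (simp add: factors_def length_concat comp_def interv_sum_list_conv_sum_set_nat atLeast0LessThan)
  also have "\<dots> \<le> (\<Sum>k<N - 1. k + 1)"
    using assms by (intro sum_mono length_word) auto
  \<comment> \<open>Using \<open>M\<close> for \<open>N - 1\<close> keeps truncated subtraction out
    of the induction.\<close>
  also have "(\<Sum>k<M. k + 1) = Suc M * M div 2" for M
    by (induction M) auto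
  then have "(\<Sum>k<N - 1. k + 1) = N * (N - 1) div 2"
    by (cases N) auto
  finally show ?thesis .
qed

section \<open>Running time\<close>

lemma fst_exec: "fst (exec f js (p, t)) = p \<circ> comp_list (map adj js)"
  by (induction js arbitrary: p t) (simp_all add: comp_assoc)

text \<open>The cost bound is available only at permutations of \<open>{0..<N}\<close>, so the
  induction must carry along that the current state remains one.\<close>

lemma snd_exec_bounds:
  assumes "\<And>p j. p permutes {0..<N} \<Longrightarrow> Suc j < N \<Longrightarrow> 0 \<le> f p j \<and> f p j \<le> C"
    and "p permutes {0..<N}" "\<And>j. j \<in> set js \<Longrightarrow> Suc j < N"
  shows "t \<le> snd (exec f js (p, t)) \<and> snd (exec f js (p, t)) \<le> t + C * real (length js)"
  using assms(2,3)
proof (induction js arbitrary: p t)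
  case (Cons j js)
  have "p \<circ> adj j permutes {0..<N}"
    using Cons.prems by (intro permutes_compose adj_permutes) auto
  then show ?case
    using Cons.IH[of "p \<circ> adj j" "t + f p j"] Cons.prems assms(1)[of p j]
    by (auto simp: algebra_simps simp del: o_apply)
qed simp

lemma snd_run_bounds:
  assumes tc: "0 \<le> tc N" "tc N \<le> C"
    and tm: "\<And>p j. p \<in> Sym N \<Longrightarrow> j \<le> N - 2 \<Longrightarrow> 0 \<le> tm N p j \<and> tm N p j \<le> C"
    and N: "N \<ge> 2"
    and q: "\<And>k. k < N - 1 \<Longrightarrow> q k \<in> PiSet k"
  shows "0 \<le> snd (run tc tm N q)" "snd (run tc tm N q) \<le> C * real N ^ 2"
proof -
  let ?l = "length (factors N q)"
  have *: "tc N \<le> snd (run tc tm N q) \<and> snd (run tc tm N q) \<le> tc N + C * real ?l"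
    unfolding run_def
  proof (rule snd_exec_bounds[of N])
    show "Suc j < N" if "j \<in> set (factors N q)" for j
      using set_factors[of N q] q that N by fastforce
  qed (use tm in \<open>auto simp: Sym_def permutes_id\<close>)
  then show "0 \<le> snd (run tc tm N q)"
    using tc by simp
  \<comment> \<open>Dropping the factor 1/2 is affordable: N(N - 1) + 1 <= N^2 still absorbs the
    additional \<open>C\<close> that bounds \<open>tc N\<close>.\<close>
  have "?l \<le> N * (N - 1)"
    using length_factors[of N q] q by (meson div_le_dividend le_trans)
  moreover have "N * (N - 1) + 1 \<le> N ^ 2"
    using N by (cases N) (simp_all add: power2_eq_square)
  ultimately have "real (?l + 1) \<le> real (N ^ 2)"
    by linarith
  moreover have "C \<ge> 0"
    using tc by simp
  ultimately have "C * (real ?l + 1) \<le> C * real N ^ 2"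
    by (intro mult_left_mono) simp_all
  then show "snd (run tc tm N q) \<le> C * real N ^ 2"
    using * tc by (simp add: algebra_simps)
qed

text \<open>The maximum over the finite nonempty support is attained, so the bounds for a single run
  suffice.\<close>

lemma worst_time_bounds:
  assumes "0 \<le> tc N" "tc N \<le> C"
    and "\<And>p j. p \<in> Sym N \<Longrightarrow> j \<le> N - 2 \<Longrightarrow> 0 \<le> tm N p j \<and> tm N p j \<le> C"
    and "N \<ge> 2"
  shows "0 \<le> worst_time tc tm N" "worst_time tc tm N \<le> C * real N ^ 2"
proof -
  have "worst_time tc tm N \<in> (\<lambda>q. snd (run tc tm N q)) ` set_pmf (choices N)"
    unfolding worst_time_def
    by (intro Max_in) (simp_all add: finite_set_pmf_choices set_pmf_not_empty)
  then obtain q where q: "q \<in> set_pmf (choices N)" "worst_time tc tm N = snd (run tc tm N q)"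
    by auto
  have "q k \<in> PiSet k" if "k < N - 1" for k
  proof -
    have "finite (PiSet k)" "PiSet k \<noteq> {}"
      by (auto simp: PiSet_def)
    then have "set_pmf (pmf_of_set (PiSet k)) = PiSet k"
      by (intro set_pmf_of_set)
    then show ?thesis
      using q(1) that by (auto simp: choices_def set_Pi_pmf PiE_dflt_def dest!: spec[of _ k])
  qed
  then show "0 \<le> worst_time tc tm N" "worst_time tc tm N \<le> C * real N ^ 2"
    using snd_run_bounds[of tc N C tm q] assms q(2) by auto
qed

theorem mainTheorem4:
  fixes tc :: "nat \<Rightarrow> real"
    and tm :: "nat \<Rightarrow> (nat \<Rightarrow> nat) \<Rightarrow> nat \<Rightarrow> real"
    and C :: real
  assumes choice_time: "\<And>N. N \<ge> 3 \<Longrightarrow> 0 \<le> tc N \<and> tc N \<le> C"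
    and mult_time: "\<And>N p j. N \<ge> 3 \<Longrightarrow> p \<in> Sym N \<Longrightarrow> j \<le> N - 2 \<Longrightarrow> 0 \<le> tm N p j \<and> tm N p j \<le> C"
  shows "(\<forall>N\<ge>3.
            map_pmf (prod_perm N) (choices N) = pmf_of_set (Sym N) \<and>
            (\<forall>\<sigma>\<in>Sym N. pmf (map_pmf (prod_perm N) (choices N)) \<sigma> = 1 / fact N) \<and>
            (\<forall>q. (\<forall>k\<le>N - 2. q k \<in> PiSet k) \<longrightarrow>
               prod_perm N q = comp_list (map adj (factors N q)) \<and>
               set (factors N q) \<subseteq> {0..N - 2} \<and>
               length (factors N q) \<le> N * (N - 1) div 2 \<and>
               fst (run tc tm N q) = prod_perm N q)) \<and>
         worst_time tc tm \<in> O(\<lambda>N. real N ^ 2)"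
proof (intro conjI allI impI ballI)
  fix N :: nat assume N: "N \<ge> 3"
  show uniform: "map_pmf (prod_perm N) (choices N) = pmf_of_set (Sym N)"
    using N by (intro map_pmf_prod_perm_choices) simp
  have Sym: "finite (Sym N)" "card (Sym N) = fact N"
    by (simp_all add: Sym_def finite_permutations card_permutations[OF refl])
  show "pmf (map_pmf (prod_perm N) (choices N)) \<sigma> = 1 / fact N" if "\<sigma> \<in> Sym N" for \<sigma>
    unfolding uniform using that Sym by (subst pmf_of_set) auto
  fix q assume "\<forall>k\<le>N - 2. q k \<in> PiSet k"
  \<comment> \<open>For N >= 3 the ranges k <= N - 2 and k < N - 1 coincide, despite truncated
    subtraction.\<close>
  then have q: "q k \<in> PiSet k" if "k < N - 1" for k
    using that N by simp
  show "prod_perm N q = comp_list (map adj (factors N q))"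
    using comp_list_factors[of N q] q by simp
  then show "fst (run tc tm N q) = prod_perm N q"
    by (simp add: run_def fst_exec)
  show "set (factors N q) \<subseteq> {0..N - 2}"
    using q by (rule set_factors)
  show "length (factors N q) \<le> N * (N - 1) div 2"
    using q by (rule length_factors)
next
  \<comment> \<open>\<open>C\<close> itself serves as the constant of the O-bound, with threshold 3;
    since the worst-case time is nonnegative, the norm leaves it unchanged.\<close>
  have "norm (worst_time tc tm N) \<le> C * norm (real N ^ 2)" if "N \<ge> 3" for N
    using worst_time_bounds[of tc N C tm] choice_time mult_time that by simp
  then show "worst_time tc tm \<in> O(\<lambda>N. real N ^ 2)"
    by (intro bigoI eventually_at_top_linorderI)
qed

end
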